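(* Let $i,j\geq 0$ be integers and $L$ a finite set of integers. The map $\operatorname{split}:T\mapsto\{T[k] : k\in Free(T)\}$ is a bijection between: - (1) alternative tableaux labeled by $L$ having exactly $i$ free rows and $j$ free columns; and - (2) sets of $i+j$ labeled packed tableaux, $i$ of which have exactly one free row and no free column and $j$ of which have no free row and exactly one free column, whose $i+j$ label sets form a partition of $L$. The inverse bijection is given by $\operatorname{merge}$, i.e. by merging all tableaux of the set.
   Context: A shape of length $n$ is a Ferrers diagram in English notation, possibly with empty rows or columns. It is determined by its south-east border, a path of $n$ unit south/west steps from the top-right corner to the bottom-left corner. South steps correspond to rows and west steps to columns. The shape is labeled by a set of integers $L=\{i_1<\dots<i_n\}$ if $i_1,\dots,i_n$ are attached to the rows and columns in the order in which their steps occur along the south-east border from top-right to bottom-left. A cell in row $i$ and column $j$ exists iff $i<j$; it is denoted $(i,j)$. An alternative tableau is a shape with a partial filling of cells by left arrows and up arrows such that every cell to the left of a left arrow in its row, and every cell above an up arrow in its column, is empty. A free row is a row with no left arrow; a free column is a column with no up arrow. $Free(T)$ is the set of labels of free rows and free columns. A packed tableau is an alternative tableau of length $n>0$ with either no free row and exactly one free column, or exactly one free row and no free column. For $k\in Free(T)$, $T(k)$ is the smallest $X\subseteq L$ with $k\in X$ such that, for every cell $(i,j)$ containing an arrow, $i\in X$ iff $j\in X$. For $A\subseteq L$, $T[A]$ is the labeled tableau with label set $A$ in which $l\in A$ labels a row (resp. column) iff it does so in $T$, and each cell $(i,j)$ has the same filling as in $T$. We write $T[k]:=T[T(k)]$.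 For $T,T'$ labeled by disjoint sets $L,L'$, $\operatorname{merge}(T,T')$ is the labeled tableau with label set $L\cup L'$, where a label is a row iff it is a row in $T$ or $T'$. A cell $(i,j)$ of it carries a left (resp. up) arrow iff either $i,j\in L$ and $(i,j)$ carries that arrow in $T$, or $i,j\in L'$ and $(i,j)$ carries that arrow in $T'$; all other cells are empty. This operation is symmetric and associative, so a finite collection of tableaux with pairwise disjoint label sets can be merged. *)

theory Defs
  imports "HOL-Library.Disjoint_Sets"
begin

text \<open>A labeled shape amounts to its finite label set together with the subset of the labels
  attached to south steps (the rows); read in increasing order, the labels then spell out the
  south-east border from top-right to bottom-left. A cell is the pair of the label of its row and
  the label of its column. The filling is given by the cells carrying a left arrow and
  the cells carrying an up arrow.\<close>

record tableau =
  labels :: "int set"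
  rows :: "int set"
  lefts :: "(int \<times> int) set"
  ups :: "(int \<times> int) set"

definition columns :: "tableau \<Rightarrow> int set" where
  "columns T = labels T - rows T"

definition cells :: "tableau \<Rightarrow> (int \<times> int) set" where
  "cells T = {(i, j). i \<in> rows T \<and> j \<in> columns T \<and> i < j}"

definition arrows :: "tableau \<Rightarrow> (int \<times> int) set" where
  "arrows T = lefts T \<union> ups T"

definition labeled_tableau :: "tableau \<Rightarrow> bool" where
  "labeled_tableau T \<longleftrightarrow>
     finite (labels T) \<and> rows T \<subseteq> labels T \<and> arrows T \<subseteq> cells T \<and> lefts T \<inter> ups T = {}"

text \<open>Labels increase from top to bottom along the rows but from right to left along the columns:
  the cells to the left of \<open>(i, j)\<close> are the \<open>(i, j')\<close> with \<open>j' > j\<close>, and the cells above it are the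
  \<open>(i', j)\<close> with \<open>i' < i\<close>.\<close>

definition alternative_tableau :: "tableau \<Rightarrow> bool" where
  "alternative_tableau T \<longleftrightarrow> labeled_tableau T \<and>
     (\<forall>i j j'. (i, j) \<in> lefts T \<and> (i, j') \<in> cells T \<and> j < j' \<longrightarrow> (i, j') \<notin> arrows T) \<and>
     (\<forall>i j i'. (i, j) \<in> ups T \<and> (i', j) \<in> cells T \<and> i' < i \<longrightarrow> (i', j) \<notin> arrows T)"

definition free_rows :: "tableau \<Rightarrow> int set" where
  "free_rows T = {i \<in> rows T. \<forall>j. (i, j) \<notin> lefts T}"

definition free_columns :: "tableau \<Rightarrow> int set" where
  "free_columns T = {j \<in> columns T. \<forall>i. (i, j) \<notin> ups T}"

definition Free :: "tableau \<Rightarrow> int set" where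
  "Free T = free_rows T \<union> free_columns T"

definition row_packed :: "tableau \<Rightarrow> bool" where
  "row_packed T \<longleftrightarrow> alternative_tableau T \<and> card (labels T) > 0 \<and>
     card (free_rows T) = 1 \<and> free_columns T = {}"

definition column_packed :: "tableau \<Rightarrow> bool" where
  "column_packed T \<longleftrightarrow> alternative_tableau T \<and> card (labels T) > 0 \<and>
     free_rows T = {} \<and> card (free_columns T) = 1"

definition packed_tableau :: "tableau \<Rightarrow> bool" where
  "packed_tableau T \<longleftrightarrow> column_packed T \<or> row_packed T"

definition component :: "tableau \<Rightarrow> int \<Rightarrow> int set" where
  "component T k =
     (LEAST X. X \<subseteq> labels T \<and> k \<in> X \<and> (\<forall>(i, j) \<in> arrows T. i \<in> X \<longleftrightarrow> j \<in> X))"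

definition restrict_tableau :: "tableau \<Rightarrow> int set \<Rightarrow> tableau" where
  "restrict_tableau T A =
     \<lparr>labels = A, rows = rows T \<inter> A, lefts = lefts T \<inter> (A \<times> A), ups = ups T \<inter> (A \<times> A)\<rparr>"

definition split_tableau :: "tableau \<Rightarrow> tableau set" where
  "split_tableau T = {restrict_tableau T (component T k) | k. k \<in> Free T}"

definition merge :: "tableau \<Rightarrow> tableau \<Rightarrow> tableau" where
  "merge T T' =
     \<lparr>labels = labels T \<union> labels T',
      rows = rows T \<union> rows T',
      lefts = lefts T \<inter> (labels T \<times> labels T) \<union> lefts T' \<inter> (labels T' \<times> labels T'),
      ups = ups T \<inter> (labels T \<times> labels T) \<union> ups T' \<inter> (labels T' \<times> labels T')\<rparr>"

lemma merge_commute: "merge T T' = merge T' T"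
  by (auto simp: merge_def)

lemma merge_assoc: "merge (merge T T') T'' = merge T (merge T' T'')"
  by (auto simp: merge_def)

interpretation merge: comp_fun_commute merge
  by standard (auto simp: merge_def fun_eq_iff)

definition empty_tableau :: tableau where
  "empty_tableau = \<lparr>labels = {}, rows = {}, lefts = {}, ups = {}\<rparr>"

text \<open>The result of merging no tableau at all is the tableau of length 0.\<close>

definition merge_all :: "tableau set \<Rightarrow> tableau" where
  "merge_all P = Finite_Set.fold merge empty_tableau P"

lemma merge_all_empty: "merge_all {} = empty_tableau"
  by (simp add: merge_all_def)

lemma merge_all_insert:
  "finite P \<Longrightarrow> T \<notin> P \<Longrightarrow> merge_all (insert T P) = merge T (merge_all P)"
  by (simp add: merge_all_def)

lemma merge_all_singleton: "labeled_tableau T \<Longrightarrow> merge_all {T} = T"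
  by (cases T)
    (auto simp: merge_all_insert merge_all_empty merge_def empty_tableau_def labeled_tableau_def
      arrows_def cells_def columns_def)

definition alternative_tableaux :: "int set \<Rightarrow> nat \<Rightarrow> nat \<Rightarrow> tableau set" where
  "alternative_tableaux L i j =
     {T. alternative_tableau T \<and> labels T = L \<and>
         card (free_rows T) = i \<and> card (free_columns T) = j}"

definition packed_partitions :: "int set \<Rightarrow> nat \<Rightarrow> nat \<Rightarrow> tableau set set" where
  "packed_partitions L i j =
     {P. finite P \<and> card P = i + j \<and> (\<forall>T \<in> P. packed_tableau T) \<and>
         card {T \<in> P. row_packed T} = i \<and> card {T \<in> P. column_packed T} = j \<and>
         inj_on labels P \<and> partition_on L (labels ` P)}"

end

(* View the arrows as edges of a graph on the labels. A row holds at most one left arrow and a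
   column at most one up arrow, so each label that is not free has a unique parent, the other end
   of its arrow. Passing from a row to its grandparent strictly decreases the label, so the graph is
   a forest with the free labels as roots, and the sets T(k) are its trees. *)

theory Submission
  imports Defs
begin

section \<open>Alternative tableaux\<close>

lemma lefts_cellD:
  assumes "labeled_tableau T" "(i, j) \<in> lefts T"
  shows "i \<in> rows T" "i \<in> labels T" "j \<in> columns T" "j \<in> labels T" "j \<notin> rows T" "i < j"
  using assms by (auto simp: labeled_tableau_def arrows_def cells_def columns_def)

lemma ups_cellD:
  assumes "labeled_tableau T" "(i, j) \<in> ups T"
  shows "i \<in> rows T" "i \<in> labels T" "j \<in> columns T" "j \<in> labels T" "j \<notin> rows T" "i < j"
  using assms by (auto simp: labeled_tableau_def arrows_def cells_def columns_def)

text \<open>Arrows sit in cells, so the premises about cells are implied and each condition becomes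
  an inequality between two arrows of one row or column. Equality is allowed because the two arrows
  may coincide.\<close>

lemma alternative_tableau_iff:
  "alternative_tableau T \<longleftrightarrow> labeled_tableau T \<and>
     (\<forall>i j j'. (i, j) \<in> lefts T \<and> (i, j') \<in> arrows T \<longrightarrow> j' \<le> j) \<and>
     (\<forall>i j i'. (i, j) \<in> ups T \<and> (i', j) \<in> arrows T \<longrightarrow> i \<le> i')"
  unfolding alternative_tableau_def labeled_tableau_def by (meson linorder_not_le subsetD)

lemma finite_free:
  assumes "labeled_tableau T"
  shows "finite (free_rows T)" "finite (free_columns T)" "finite (Free T)"
  using assms
  by (auto simp: labeled_tableau_def free_rows_def free_columns_def Free_def columns_def
      intro: finite_subset)

lemma Free_subset_labels: "labeled_tableau T \<Longrightarrow> Free T \<subseteq> labels T"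
  by (auto simp: labeled_tableau_def free_rows_def free_columns_def Free_def columns_def)

lemma free_rows_columns_disjoint: "free_rows T \<inter> free_columns T = {}"
  by (auto simp: free_rows_def free_columns_def columns_def)

section \<open>Components as least arrow-closed sets\<close>

definition arrow_closed :: "tableau \<Rightarrow> int set \<Rightarrow> bool" where
  "arrow_closed T X \<longleftrightarrow> (\<forall>(i, j) \<in> arrows T. i \<in> X \<longleftrightarrow> j \<in> X)"

lemma arrow_closed_iff: "arrow_closed T X \<longleftrightarrow> (\<forall>i j. (i, j) \<in> arrows T \<longrightarrow> (i \<in> X \<longleftrightarrow> j \<in> X))"
  by (auto simp: arrow_closed_def)

lemma arrow_closed_labels: "labeled_tableau T \<Longrightarrow> arrow_closed T (labels T)"
  by (auto simp: arrow_closed_iff arrows_def dest: lefts_cellD ups_cellD)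

lemma arrow_closed_Inter: "(\<And>X. X \<in> F \<Longrightarrow> arrow_closed T X) \<Longrightarrow> arrow_closed T (\<Inter>F)"
  by (simp add: arrow_closed_iff)

text \<open>The sets over which \<open>LEAST\<close> ranges include \<open>labels T\<close> and are
  stable under nonempty intersections, so a least one exists and is the intersection of them
  all.\<close>

lemma component_eq:
  assumes "k \<in> labels T" "labeled_tableau T"
  shows "component T k = \<Inter>{X. X \<subseteq> labels T \<and> k \<in> X \<and> arrow_closed T X}" (is "_ = \<Inter>?F")
  unfolding component_def arrow_closed_def[symmetric]
proof (rule Least_equality)
  have "labels T \<in> ?F" using assms arrow_closed_labels by simp
  moreover have "arrow_closed T (\<Inter>?F)" by (rule arrow_closed_Inter) simp
  ultimately show "\<Inter>?F \<subseteq> labels T \<and> k \<in> \<Inter>?F \<and> arrow_closed T (\<Inter>?F)"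
    by (intro conjI Inter_lower) auto
qed (intro Inter_lower, simp)

lemma component_props:
  assumes "k \<in> labels T" "labeled_tableau T"
  shows "component T k \<subseteq> labels T" "k \<in> component T k" "arrow_closed T (component T k)"
proof -
  show "component T k \<subseteq> labels T" "k \<in> component T k"
    using assms(1) arrow_closed_labels[OF assms(2)] by (auto simp: component_eq[OF assms])
  show "arrow_closed T (component T k)"
    unfolding component_eq[OF assms] by (rule arrow_closed_Inter) simp
qed

lemma component_minimal:
  assumes "k \<in> labels T" "labeled_tableau T" "X \<subseteq> labels T" "k \<in> X" "arrow_closed T X"
  shows "component T k \<subseteq> X"
  using assms(3-) by (auto simp: component_eq[OF assms(1,2)])

section \<open>The forest of parents\<close>

text \<open>Pairs are (child, parent). A left arrow belongs to its row and an up arrow to its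
  column, hence the converse on \<open>ups T\<close> only.\<close>

definition parent :: "tableau \<Rightarrow> (int \<times> int) set" where
  "parent T = lefts T \<union> (ups T)\<inverse>"

text \<open>A row can be the child only through a left arrow and a column only through an up arrow.
  Applying the condition on such arrows to the pair in both orders gives two opposite
  inequalities.\<close>

lemma single_valued_parent:
  assumes "alternative_tableau T"
  shows "single_valued (parent T)"
proof (rule single_valuedI)
  fix x y z assume xy: "(x, y) \<in> parent T" and xz: "(x, z) \<in> parent T"
  have T: "labeled_tableau T" using assms by (simp add: alternative_tableau_iff)
  show "y = z"
  proof (cases "x \<in> rows T")
    case True
    then have "(x, y) \<in> lefts T" "(x, z) \<in> lefts T"
      using xy xz ups_cellD(5)[OF T] by (auto simp: parent_def)
    then have "y \<le> z" "z \<le> y"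
      using assms unfolding alternative_tableau_iff arrows_def by blast+
    then show ?thesis by simp
  next
    case False
    then have "(y, x) \<in> ups T" "(z, x) \<in> ups T"
      using xy xz lefts_cellD(1)[OF T] by (auto simp: parent_def)
    then have "y \<le> z" "z \<le> y"
      using assms unfolding alternative_tableau_iff arrows_def by blast+
    then show ?thesis by simp
  qed
qed

lemma Free_not_Domain_parent:
  assumes "labeled_tableau T" "k \<in> Free T"
  shows "(k, l) \<notin> parent T"
  using assms lefts_cellD[OF assms(1)] ups_cellD[OF assms(1)]
  by (auto simp: parent_def Free_def free_rows_def free_columns_def columns_def)

text \<open>The climb alternates between rows and columns, and only its row labels decrease.
  Integers being unbounded below, the induction counts the finitely many rows with smaller
  labels.\<close>

lemma row_reaches_Free:
  assumes "alternative_tableau T" "i \<in> rows T"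
  shows "\<exists>k \<in> Free T. (i, k) \<in> (parent T)\<^sup>*"
  using assms(2)
proof (induction "card {r \<in> rows T. r < i}" arbitrary: i rule: less_induct)
  case less
  have T: "labeled_tableau T" using assms by (simp add: alternative_tableau_iff)
  show ?case
  proof (cases "i \<in> free_rows T")
    case True
    then show ?thesis by (auto simp: Free_def)
  next
    case False
    then obtain j where ij: "(i, j) \<in> lefts T"
      using less.prems by (auto simp: free_rows_def)
    then have par: "(i, j) \<in> parent T" by (simp add: parent_def)
    show ?thesis
    proof (cases "j \<in> free_columns T")
      case True
      then show ?thesis using par by (auto simp: Free_def)
    next
      case False
      then obtain i' where i'j: "(i', j) \<in> ups T"
        using lefts_cellD[OF T ij] by (auto simp: free_columns_def)
      \<comment> \<open>The cell \<open>(i, j)\<close> holds a left arrow, hence no up arrow; being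
        filled, it cannot lie above the up arrow in \<open>(i', j)\<close>.\<close>
      have "i' \<noteq> i" using ij i'j T by (auto simp: labeled_tableau_def)
      moreover have "i' \<le> i"
        using assms(1) ij i'j unfolding alternative_tableau_iff arrows_def by blast
      ultimately have "i' < i" by simp
      moreover have "i' \<in> rows T" using ups_cellD[OF T i'j] by simp
      moreover have "finite (rows T)"
        using T by (auto simp: labeled_tableau_def intro: finite_subset)
      ultimately have "card {r \<in> rows T. r < i'} < card {r \<in> rows T. r < i}"
        by (intro psubset_card_mono) (force simp: psubset_eq)+
      from less.hyps[OF this \<open>i' \<in> rows T\<close>] obtain k
        where "k \<in> Free T" "(i', k) \<in> (parent T)\<^sup>*" by blast
      moreover have "(j, i') \<in> parent T" using i'j by (simp add: parent_def)
      ultimately show ?thesis using par by (meson converse_rtrancl_into_rtrancl)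
    qed
  qed
qed

lemma label_reaches_Free:
  assumes "alternative_tableau T" "l \<in> labels T"
  shows "\<exists>k \<in> Free T. (l, k) \<in> (parent T)\<^sup>*"
proof (cases "l \<in> rows T \<or> l \<in> free_columns T")
  case True
  then show ?thesis using row_reaches_Free[OF assms(1)] by (auto simp: Free_def)
next
  case False
  have T: "labeled_tableau T" using assms by (simp add: alternative_tableau_iff)
  from False obtain i where il: "(i, l) \<in> ups T"
    using assms(2) by (auto simp: free_columns_def columns_def)
  then have "(l, i) \<in> parent T" by (simp add: parent_def)
  then show ?thesis
    using row_reaches_Free[OF assms(1) ups_cellD(1)[OF T il]]
    by (meson converse_rtrancl_into_rtrancl)
qed

section \<open>Components of free labels as the trees of the forest\<close>

lemma reaches_closed:
  assumes "arrow_closed T X" "(l, k) \<in> (parent T)\<^sup>*"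
  shows "l \<in> X \<longleftrightarrow> k \<in> X"
  using assms(2)
proof induction
  case (step y z)
  then show ?case
    using assms(1) by (auto simp: arrow_closed_def parent_def arrows_def)
qed simp

text \<open>From left to right, the path from \<open>a\<close> to \<open>k\<close> is not empty,
  since the root \<open>k\<close> has no parent while \<open>a\<close> has the parent
  \<open>b\<close>; its first step then leads to \<open>b\<close> by uniqueness.\<close>

lemma reaches_Free_step:
  assumes "alternative_tableau T" "k \<in> Free T" "(a, b) \<in> parent T"
  shows "(a, k) \<in> (parent T)\<^sup>* \<longleftrightarrow> (b, k) \<in> (parent T)\<^sup>*"
proof
  assume "(a, k) \<in> (parent T)\<^sup>*"
  then show "(b, k) \<in> (parent T)\<^sup>*"
  proof (cases rule: converse_rtranclE)
    case base
    then show ?thesis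
      using assms Free_not_Domain_parent by (auto simp: alternative_tableau_iff)
  next
    case (step c)
    then show ?thesis
      using single_valuedD[OF single_valued_parent[OF assms(1)] assms(3)] by blast
  qed
qed (use assms(3) in \<open>rule converse_rtrancl_into_rtrancl\<close>)

text \<open>A closed set containing \<open>k\<close> contains every label that climbs to
  \<open>k\<close>. Conversely, these labels form a closed set, because a parent step does not
  change whether \<open>k\<close> is reached.\<close>

lemma component_Free:
  assumes "alternative_tableau T" "k \<in> Free T"
  shows "component T k = {l. (l, k) \<in> (parent T)\<^sup>*}"
proof
  have T: "labeled_tableau T" using assms by (simp add: alternative_tableau_iff)
  then have k: "k \<in> labels T" using assms(2) Free_subset_labels by blast
  show "{l. (l, k) \<in> (parent T)\<^sup>*} \<subseteq> component T k"
    using reaches_closed component_props[OF k T] by blast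
  \<comment> \<open>Such an \<open>l\<close> is \<open>k\<close> itself or an end of an
    arrow.\<close>
  have "l \<in> labels T" if "(l, k) \<in> (parent T)\<^sup>*" for l
    using that k
    by (cases rule: converse_rtranclE) (auto simp: parent_def dest: lefts_cellD[OF T] ups_cellD[OF T])
  moreover have "arrow_closed T {l. (l, k) \<in> (parent T)\<^sup>*}"
    using reaches_Free_step[OF assms] by (force simp: arrow_closed_def arrows_def parent_def)
  ultimately show "component T k \<subseteq> {l. (l, k) \<in> (parent T)\<^sup>*}"
    by (intro component_minimal[OF k T]) auto
qed

text \<open>Two paths from one label along a single-valued relation are comparable, so one of the
  roots reaches the other; a root has no outgoing step, so they coincide.\<close>

lemma component_disjoint:
  assumes "alternative_tableau T" "k \<in> Free T" "k' \<in> Free T"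
    "l \<in> component T k" "l \<in> component T k'"
  shows "k = k'"
proof -
  have T: "labeled_tableau T" using assms by (simp add: alternative_tableau_iff)
  have "(l, k) \<in> (parent T)\<^sup>*" "(l, k') \<in> (parent T)\<^sup>*"
    using assms component_Free by auto
  then have "(k, k') \<in> (parent T)\<^sup>* \<or> (k', k) \<in> (parent T)\<^sup>*"
    using single_valued_confluent[OF single_valued_parent[OF assms(1)]] by blast
  then show ?thesis
    using Free_not_Domain_parent[OF T] assms(2,3) by (metis converse_rtranclE)
qed

lemma components_cover:
  assumes "alternative_tableau T"
  shows "(\<Union>k \<in> Free T. component T k) = labels T"
proof -
  have T: "labeled_tableau T" using assms by (simp add: alternative_tableau_iff)
  have "component T k \<subseteq> labels T" if "k \<in> Free T" for k
    using component_props(1)[OF _ T] Free_subset_labels[OF T] that by blast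
  moreover have "\<exists>k \<in> Free T. l \<in> component T k" if "l \<in> labels T" for l
    using label_reaches_Free[OF assms that] component_Free[OF assms] by simp
  ultimately show ?thesis by blast
qed

text \<open>Recognizes a tree from outside, as needed for the blocks of a merge: every label of
  \<open>A\<close> climbs to a free label, closedness keeps the climb inside \<open>A\<close>, and
  \<open>k\<close> is the only root there.\<close>

lemma component_eqI:
  assumes "alternative_tableau T" "A \<subseteq> labels T" "arrow_closed T A" "Free T \<inter> A = {k}"
  shows "component T k = A"
proof
  have T: "labeled_tableau T" using assms by (simp add: alternative_tableau_iff)
  then have k: "k \<in> labels T" "k \<in> Free T" "k \<in> A" using assms(2,4) by auto
  show "component T k \<subseteq> A" using component_minimal[OF k(1) T assms(2) k(3) assms(3)] .
  show "A \<subseteq> component T k"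
  proof
    fix l assume "l \<in> A"
    then obtain k' where k': "k' \<in> Free T" "(l, k') \<in> (parent T)\<^sup>*"
      using label_reaches_Free[OF assms(1)] assms(2) by blast
    then have "k' = k"
      using reaches_closed[OF assms(3)] \<open>l \<in> A\<close> assms(4) by blast
    then show "l \<in> component T k" using k' component_Free[OF assms(1)] by simp
  qed
qed

section \<open>Splitting\<close>

lemma restrict_simps [simp]:
  "labels (restrict_tableau T A) = A"
  "rows (restrict_tableau T A) = rows T \<inter> A"
  "lefts (restrict_tableau T A) = lefts T \<inter> (A \<times> A)"
  "ups (restrict_tableau T A) = ups T \<inter> (A \<times> A)"
  by (simp_all add: restrict_tableau_def)

text \<open>In the form of \<open>alternative_tableau_iff\<close> the conditions compare arrows
  only, so they pass to subsets of the arrows.\<close>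

lemma alternative_restrict:
  assumes "alternative_tableau T" "A \<subseteq> labels T"
  shows "alternative_tableau (restrict_tableau T A)"
proof -
  have "labeled_tableau (restrict_tableau T A)"
    using assms unfolding alternative_tableau_iff labeled_tableau_def
    by (auto simp: arrows_def cells_def columns_def intro: finite_subset)
  moreover have "lefts (restrict_tableau T A) \<subseteq> lefts T" "ups (restrict_tableau T A) \<subseteq> ups T"
    "arrows (restrict_tableau T A) \<subseteq> arrows T"
    by (auto simp: arrows_def)
  ultimately show ?thesis
    using assms(1) unfolding alternative_tableau_iff by (meson subsetD)
qed

text \<open>Cutting along a closed set keeps every arrow of a row or column in \<open>A\<close>, so
  no label becomes free by restriction.\<close>

lemma free_restrict:
  assumes "A \<subseteq> labels T" "arrow_closed T A"
  shows "free_rows (restrict_tableau T A) = free_rows T \<inter> A"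
    and "free_columns (restrict_tableau T A) = free_columns T \<inter> A"
proof -
  have "i \<in> A \<longleftrightarrow> j \<in> A" if "(i, j) \<in> lefts T \<or> (i, j) \<in> ups T" for i j
    using assms(2) that unfolding arrow_closed_def arrows_def by blast
  then show "free_rows (restrict_tableau T A) = free_rows T \<inter> A"
    "free_columns (restrict_tableau T A) = free_columns T \<inter> A"
    using assms(1) by (auto simp: free_rows_def free_columns_def columns_def)
qed

section \<open>The trees \<open>T[k]\<close> as packed tableaux\<close>

definition tree :: "tableau \<Rightarrow> int \<Rightarrow> tableau" where
  "tree T k = restrict_tableau T (component T k)"

lemma split_eq_image: "split_tableau T = tree T ` Free T"
  by (auto simp: split_tableau_def tree_def)

lemma labels_tree [simp]: "labels (tree T k) = component T k"
  by (simp add: tree_def)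

lemma tree_props:
  assumes "alternative_tableau T" "k \<in> Free T"
  shows "alternative_tableau (tree T k)" "card (labels (tree T k)) > 0"
    "free_rows (tree T k) = free_rows T \<inter> {k}" "free_columns (tree T k) = free_columns T \<inter> {k}"
proof -
  have T: "labeled_tableau T" using assms by (simp add: alternative_tableau_iff)
  then have k: "k \<in> labels T" using assms(2) Free_subset_labels by blast
  note C = component_props[OF k T]
  show "alternative_tableau (tree T k)"
    unfolding tree_def by (rule alternative_restrict[OF assms(1) C(1)])
  have "finite (component T k)"
    using T C(1) by (auto simp: labeled_tableau_def intro: finite_subset)
  then show "card (labels (tree T k)) > 0"
    using C(2) by (auto simp: card_gt_0_iff)
  \<comment> \<open>Any other free label lies in its own component, which is disjoint from this
    one.\<close>
  have "Free T \<inter> component T k = {k}"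
    using component_disjoint[OF assms(1)] assms(2) C(2) component_props(2)[OF _ T]
      Free_subset_labels[OF T] by blast
  then show "free_rows (tree T k) = free_rows T \<inter> {k}"
    "free_columns (tree T k) = free_columns T \<inter> {k}"
    using free_restrict[OF C(1,3)] unfolding tree_def Free_def by blast+
qed

text \<open>By \<open>tree_props\<close> the root is the only free label of its tree, so the kind of
  packed tableau records whether the root is a row or a column.\<close>

lemma tree_packed_iff:
  assumes "alternative_tableau T" "k \<in> Free T"
  shows "row_packed (tree T k) \<longleftrightarrow> k \<in> free_rows T"
    "column_packed (tree T k) \<longleftrightarrow> k \<in> free_columns T"
proof -
  have "k \<in> free_rows T \<or> k \<in> free_columns T" "k \<notin> free_rows T \<or> k \<notin> free_columns T"
    using assms(2) free_rows_columns_disjoint[of T] by (auto simp: Free_def)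
  then show "row_packed (tree T k) \<longleftrightarrow> k \<in> free_rows T"
    "column_packed (tree T k) \<longleftrightarrow> k \<in> free_columns T"
    unfolding row_packed_def column_packed_def tree_props(3,4)[OF assms]
    using tree_props(1,2)[OF assms] by (cases "k \<in> free_rows T"; simp)+
qed

lemma inj_on_component:
  assumes "alternative_tableau T"
  shows "inj_on (component T) (Free T)"
proof (rule inj_onI)
  fix k k' assume "k \<in> Free T" "k' \<in> Free T" "component T k = component T k'"
  then show "k = k'"
    using component_disjoint[OF assms] component_props(2) Free_subset_labels assms
    by (metis alternative_tableau_iff subsetD)
qed

lemma partition_on_components:
  assumes "alternative_tableau T"
  shows "partition_on (labels T) (component T ` Free T)"
proof (rule partition_onI)
  show "\<Union> (component T ` Free T) = labels T" using components_cover[OF assms] by simp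
  show "{} \<notin> component T ` Free T"
    using component_props(2) Free_subset_labels assms
    unfolding alternative_tableau_iff by blast
  show "disjnt p q" if "p \<in> component T ` Free T" "q \<in> component T ` Free T" "p \<noteq> q" for p q
    using that component_disjoint[OF assms] unfolding disjnt_def by blast
qed

lemma split_in_packed_partitions:
  assumes "T \<in> alternative_tableaux L i j"
  shows "split_tableau T \<in> packed_partitions L i j"
proof -
  have alt: "alternative_tableau T" and L: "labels T = L"
    and cards: "card (free_rows T) = i" "card (free_columns T) = j"
    using assms by (auto simp: alternative_tableaux_def)
  have T: "labeled_tableau T" using alt by (simp add: alternative_tableau_iff)
  \<comment> \<open>The label set of a tree is a component, which already determines the
    root.\<close>
  have inj: "inj_on (tree T) (Free T)"
    using inj_on_component[OF alt] by (metis inj_onI inj_onD labels_tree)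
  have lab: "labels ` tree T ` Free T = component T ` Free T" by (simp add: image_image)
  \<comment> \<open>Trees of each kind are the images of the free labels of that kind, so
    injectivity transfers the counts from \<open>T\<close> to the set of trees.\<close>
  have "{S \<in> tree T ` Free T. row_packed S} = tree T ` free_rows T"
    using tree_packed_iff[OF alt] by (auto simp: Free_def)
  moreover have "{S \<in> tree T ` Free T. column_packed S} = tree T ` free_columns T"
    using tree_packed_iff[OF alt] by (auto simp: Free_def)
  moreover have "\<forall>S \<in> tree T ` Free T. packed_tableau S"
    using tree_packed_iff[OF alt] by (auto simp: Free_def packed_tableau_def)
  moreover have "card (Free T) = i + j"
    using cards finite_free[OF T] free_rows_columns_disjoint[of T]
    by (simp add: Free_def card_Un_disjoint)
  moreover have "inj_on labels (tree T ` Free T)"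
    using inj_on_component[OF alt] by (auto simp: inj_on_def)
  moreover have "card (tree T ` free_rows T) = i" "card (tree T ` free_columns T) = j"
    using inj cards by (auto intro!: card_image[THEN trans] simp: Free_def elim: inj_on_subset)
  ultimately show ?thesis
    using finite_free[OF T] card_image[OF inj] partition_on_components[OF alt] L
    by (simp add: packed_partitions_def split_eq_image lab)
qed

section \<open>Merging\<close>

text \<open>Both ends of an arrow of a labeled tableau are among its labels, so the intersections in
  \<open>merge\<close> remove nothing and the fold takes unions field by field.\<close>

lemma merge_all_eq:
  assumes "finite P" "\<forall>T \<in> P. labeled_tableau T"
  shows "merge_all P = \<lparr>labels = \<Union>(labels ` P), rows = \<Union>(rows ` P),
    lefts = \<Union>(lefts ` P), ups = \<Union>(ups ` P)\<rparr>"
  using assms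
proof (induction P rule: finite_induct)
  case empty
  then show ?case by (simp add: merge_all_empty empty_tableau_def)
next
  case (insert T P)
  have *: "lefts S \<subseteq> labels S \<times> labels S" "ups S \<subseteq> labels S \<times> labels S"
    if "S \<in> insert T P" for S
    using insert.prems that lefts_cellD(2,4) ups_cellD(2,4) by auto
  have "(\<Union>(lefts ` P)) \<inter> (\<Union>(labels ` P) \<times> \<Union>(labels ` P)) = \<Union>(lefts ` P)"
    "(\<Union>(ups ` P)) \<inter> (\<Union>(labels ` P) \<times> \<Union>(labels ` P)) = \<Union>(ups ` P)"
    using *[OF insertI2] by blast+
  then show ?case
    using insert *[of T] by (simp add: merge_all_insert merge_def Int_absorb2)
qed

section \<open>Blocks of a packed partition inside their merge\<close>

lemma packed_alternative: "packed_tableau T \<Longrightarrow> alternative_tableau T"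
  by (auto simp: packed_tableau_def row_packed_def column_packed_def)

text \<open>Overlapping blocks of a partition are equal, and injectivity of \<open>labels\<close> on
  \<open>P\<close> rules out two tableaux on one block.\<close>

lemma packed_partitions_disjoint:
  assumes "P \<in> packed_partitions L i j" "S \<in> P" "S' \<in> P" "l \<in> labels S" "l \<in> labels S'"
  shows "S = S'"
proof -
  have "labels S = labels S'"
    using assms unfolding packed_partitions_def partition_on_def disjoint_def by blast
  then show ?thesis using assms by (auto simp: packed_partitions_def dest: inj_onD)
qed

text \<open>A label of \<open>S\<close> belongs to no other tableau of \<open>P\<close>, so any row
  or arrow of the merge that meets \<open>labels S\<close> comes from \<open>S\<close>.\<close>

lemma merge_all_restrict:
  assumes "P \<in> packed_partitions L i j" "S \<in> P"
  shows "restrict_tableau (merge_all P) (labels S) = S" "arrow_closed (merge_all P) (labels S)"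
    "labels S \<subseteq> labels (merge_all P)"
proof -
  have fin: "finite P" and lab: "\<And>S. S \<in> P \<Longrightarrow> labeled_tableau S"
    using assms(1) packed_alternative by (auto simp: packed_partitions_def alternative_tableau_iff)
  note M = merge_all_eq[OF fin]
  note disj = packed_partitions_disjoint[OF assms(1) _ assms(2)]
  have rows: "rows S' \<subseteq> labels S'" if "S' \<in> P" for S'
    using lab[OF that] by (simp add: labeled_tableau_def)
  have arr: "lefts S' \<subseteq> labels S' \<times> labels S'" "ups S' \<subseteq> labels S' \<times> labels S'" if "S' \<in> P" for S'
    using lefts_cellD(2,4)[OF lab[OF that]] ups_cellD(2,4)[OF lab[OF that]] by auto
  have "\<Union>(rows ` P) \<inter> labels S = rows S"
    using rows disj assms(2) by blast
  moreover have "\<Union>(lefts ` P) \<inter> (labels S \<times> labels S) = lefts S"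
    "\<Union>(ups ` P) \<inter> (labels S \<times> labels S) = ups S"
    using arr disj assms(2) by blast+
  ultimately show "restrict_tableau (merge_all P) (labels S) = S"
    using lab by (simp add: restrict_tableau_def M)
  have "i \<in> labels S \<longleftrightarrow> j \<in> labels S" if ij: "(i, j) \<in> arrows (merge_all P)" for i j
  proof -
    obtain S' where "S' \<in> P" "(i, j) \<in> lefts S' \<or> (i, j) \<in> ups S'"
      using ij lab by (auto simp: M arrows_def)
    then show ?thesis using arr disj by blast
  qed
  then show "arrow_closed (merge_all P) (labels S)" by (auto simp: arrow_closed_def)
  show "labels S \<subseteq> labels (merge_all P)" using assms(2) lab by (auto simp: M)
qed

lemma labels_merge_all:
  assumes "P \<in> packed_partitions L i j"
  shows "labels (merge_all P) = L"
proof -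
  have "finite P" "\<forall>S \<in> P. labeled_tableau S" "\<Union>(labels ` P) = L"
    using assms packed_alternative
    by (auto simp: packed_partitions_def alternative_tableau_iff partition_on_def)
  then show ?thesis by (simp add: merge_all_eq)
qed

text \<open>Arrows in a common row or column share a label, so they come from the same tableau of
  \<open>P\<close>, where the conditions on them are known.\<close>

lemma alternative_merge_all:
  assumes "P \<in> packed_partitions L i j" "finite L"
  shows "alternative_tableau (merge_all P)"
proof -
  have fin: "finite P" and alt: "\<And>S. S \<in> P \<Longrightarrow> alternative_tableau S"
    using assms(1) packed_alternative by (auto simp: packed_partitions_def)
  then have lab: "\<And>S. S \<in> P \<Longrightarrow> labeled_tableau S" by (simp add: alternative_tableau_iff)
  note M = merge_all_eq[OF fin]
  note disj = packed_partitions_disjoint[OF assms(1)]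
  have rows: "rows S \<subseteq> labels S" if "S \<in> P" for S
    using lab[OF that] by (simp add: labeled_tableau_def)
  have arr: "i \<in> rows S \<and> i \<in> labels S \<and> j \<in> labels S \<and> j \<notin> rows S \<and> i < j"
    if "S \<in> P" "(i, j) \<in> arrows S" for S i j
    using lefts_cellD[OF lab[OF that(1)]] ups_cellD[OF lab[OF that(1)]] that(2)
    by (auto simp: arrows_def)
  have arrM: "arrows (merge_all P) = \<Union>(arrows ` P)"
    using lab by (auto simp: M arrows_def)
  have sub: "(i, j) \<in> lefts S \<Longrightarrow> (i, j) \<in> arrows S" "(i, j) \<in> ups S \<Longrightarrow> (i, j) \<in> arrows S" for i j S
    by (auto simp: arrows_def)
  have "arrows (merge_all P) \<subseteq> cells (merge_all P)"
  proof clarify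
    fix i j assume "(i, j) \<in> arrows (merge_all P)"
    then obtain S where S: "S \<in> P" "(i, j) \<in> arrows S" by (auto simp: arrM)
    \<comment> \<open>A column of the merge must be a row in no tableau of \<open>P\<close>. A
      tableau with \<open>j\<close> among its rows would share \<open>j\<close> with
      \<open>S\<close> and thus be \<open>S\<close>, where \<open>j\<close> is a column.\<close>
    have "j \<notin> rows S'" if "S' \<in> P" for S'
      using arr[OF S] disj[OF S(1) that] rows[OF that] by blast
    then show "(i, j) \<in> cells (merge_all P)"
      using arr[OF S] S(1) lab by (auto simp: M cells_def columns_def)
  qed
  moreover have "lefts (merge_all P) \<inter> ups (merge_all P) = {}"
  proof -
    have False if "S \<in> P" "S' \<in> P" "(i, j) \<in> lefts S" "(i, j) \<in> ups S'" for S S' i j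
    proof -
      have "S = S'" using that arr sub disj by metis
      then show False using that lab[OF that(1)] by (auto simp: labeled_tableau_def)
    qed
    then show ?thesis using lab by (auto simp: M)
  qed
  moreover have "rows (merge_all P) \<subseteq> labels (merge_all P)"
    using rows lab by (auto simp: M)
  ultimately have "labeled_tableau (merge_all P)"
    using assms(2) labels_merge_all[OF assms(1)] by (simp add: labeled_tableau_def)
  moreover have "j' \<le> j" if arrows: "(i, j) \<in> lefts (merge_all P)" "(i, j') \<in> arrows (merge_all P)" for i j j'
  proof -
    obtain S S' where S: "S \<in> P" "S' \<in> P" "(i, j) \<in> lefts S" "(i, j') \<in> arrows S'"
      using arrows lab unfolding arrM by (auto simp: M)
    then have "S = S'" using arr sub disj by metis
    then show ?thesis using S alt unfolding alternative_tableau_iff by blast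
  qed
  moreover have "i \<le> i'" if arrows: "(i, j) \<in> ups (merge_all P)" "(i', j) \<in> arrows (merge_all P)" for i i' j
  proof -
    obtain S S' where S: "S \<in> P" "S' \<in> P" "(i, j) \<in> ups S" "(i', j) \<in> arrows S'"
      using arrows lab unfolding arrM by (auto simp: M)
    then have "S = S'" using arr sub disj by metis
    then show ?thesis using S alt unfolding alternative_tableau_iff by blast
  qed
  ultimately show ?thesis unfolding alternative_tableau_iff by blast
qed

section \<open>Splitting and merging as mutual inverses\<close>

lemma tree_merge_all:
  assumes "P \<in> packed_partitions L i j" "finite L" "S \<in> P" "k \<in> Free S"
  shows "k \<in> Free (merge_all P)" "tree (merge_all P) k = S"
proof -
  note M = merge_all_restrict[OF assms(1,3)]
  \<comment> \<open>\<open>S\<close> is the restriction of the merge to a closed set, so freeness in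
    \<open>S\<close> agrees with freeness in the merge.\<close>
  have F: "Free S = Free (merge_all P) \<inter> labels S"
    using free_restrict[OF M(3,2)] M(1) by (auto simp: Free_def)
  then show "k \<in> Free (merge_all P)" using assms(4) by blast
  have "card (Free S) = 1"
    using assms(1,3)
    by (auto simp: packed_partitions_def packed_tableau_def row_packed_def column_packed_def Free_def)
  then have "Free S = {k}" using assms(4) by (auto simp: card_1_singleton_iff)
  then have "component (merge_all P) k = labels S"
    using component_eqI[OF alternative_merge_all[OF assms(1,2)] M(3,2)] F by simp
  then show "tree (merge_all P) k = S" by (simp add: tree_def M(1))
qed

lemma split_merge_all:
  assumes "P \<in> packed_partitions L i j" "finite L"
  shows "split_tableau (merge_all P) = P"
proof
  have packed: "packed_tableau S" if "S \<in> P" for S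
    using assms(1) that by (simp add: packed_partitions_def)
  show "P \<subseteq> split_tableau (merge_all P)"
  proof
    fix S assume S: "S \<in> P"
    then obtain k where "k \<in> Free S"
      using packed[OF S]
      by (auto simp: packed_tableau_def row_packed_def column_packed_def Free_def card_1_singleton_iff)
    from tree_merge_all[OF assms S this] show "S \<in> split_tableau (merge_all P)"
      unfolding split_eq_image by force
  qed
  show "split_tableau (merge_all P) \<subseteq> P"
    unfolding split_eq_image
  proof clarify
    fix k assume k: "k \<in> Free (merge_all P)"
    then have "k \<in> labels (merge_all P)"
      using alternative_merge_all[OF assms] Free_subset_labels by (auto simp: alternative_tableau_iff)
    then have "k \<in> \<Union>(labels ` P)"
      using labels_merge_all[OF assms(1)] assms(1) by (auto simp: packed_partitions_def partition_on_def)
    then obtain S where S: "S \<in> P" "k \<in> labels S" by blast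
    note M = merge_all_restrict[OF assms(1) S(1)]
    \<comment> \<open>The block owning \<open>k\<close> is closed, so \<open>k\<close> stays free in
      it and the tree of \<open>k\<close> in the merge is that block.\<close>
    have "k \<in> Free S"
      using free_restrict[OF M(3,2)] M(1) k S(2) by (auto simp: Free_def)
    then show "tree (merge_all P) k \<in> P" using tree_merge_all[OF assms S(1)] S(1) by simp
  qed
qed

text \<open>Since \<open>P\<close> is the split of its own merge, the injection \<open>tree\<close>
  matches the free rows and columns of the merge with the row-packed and column-packed members of
  \<open>P\<close>.\<close>

lemma merge_all_in_alternative_tableaux:
  assumes "P \<in> packed_partitions L i j" "finite L"
  shows "merge_all P \<in> alternative_tableaux L i j"
proof -
  let ?M = "merge_all P"
  have alt: "alternative_tableau ?M" by (rule alternative_merge_all[OF assms])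
  have P: "P = tree ?M ` Free ?M"
    using split_merge_all[OF assms] by (simp add: split_eq_image)
  have inj: "inj_on (tree ?M) (Free ?M)"
    using inj_on_component[OF alt] by (metis inj_onI inj_onD labels_tree)
  have "{S \<in> P. row_packed S} = tree ?M ` free_rows ?M"
    "{S \<in> P. column_packed S} = tree ?M ` free_columns ?M"
    using tree_packed_iff[OF alt] by (subst P; auto simp: Free_def)+
  moreover have "card (tree ?M ` free_rows ?M) = card (free_rows ?M)"
    "card (tree ?M ` free_columns ?M) = card (free_columns ?M)"
    using inj by (auto intro!: card_image simp: Free_def elim: inj_on_subset)
  ultimately show ?thesis
    using alt labels_merge_all[OF assms(1)] assms(1)
    by (simp add: alternative_tableaux_def packed_partitions_def)
qed

text \<open>The components cover the labels and no arrow joins two of them, so every row and every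
  arrow survives in some tree.\<close>

lemma merge_all_split:
  assumes "alternative_tableau T"
  shows "merge_all (split_tableau T) = T"
proof -
  have T: "labeled_tableau T" using assms by (simp add: alternative_tableau_iff)
  have fin: "finite (split_tableau T)"
    using finite_free[OF T] by (simp add: split_eq_image)
  have lab: "\<forall>S \<in> split_tableau T. labeled_tableau S"
    using tree_props(1)[OF assms] by (auto simp: split_eq_image alternative_tableau_iff)
  have cover: "\<exists>k \<in> Free T. l \<in> component T k" if "l \<in> labels T" for l
    using components_cover[OF assms] that by blast
  have arr: "i \<in> component T k \<longleftrightarrow> j \<in> component T k"
    if "k \<in> Free T" "(i, j) \<in> arrows T" for i j k
    using component_props(3)[OF _ T] Free_subset_labels[OF T] that by (auto simp: arrow_closed_def)
  have "(\<Union>k \<in> Free T. rows T \<inter> component T k) = rows T"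
    using cover T unfolding labeled_tableau_def by blast
  moreover have "(\<Union>k \<in> Free T. lefts T \<inter> (component T k \<times> component T k)) = lefts T"
  proof -
    have "\<exists>k \<in> Free T. i \<in> component T k \<and> j \<in> component T k" if "(i, j) \<in> lefts T" for i j
      using cover[OF lefts_cellD(2)[OF T that]] arr that unfolding arrows_def by blast
    then show ?thesis by auto
  qed
  moreover have "(\<Union>k \<in> Free T. ups T \<inter> (component T k \<times> component T k)) = ups T"
  proof -
    have "\<exists>k \<in> Free T. i \<in> component T k \<and> j \<in> component T k" if "(i, j) \<in> ups T" for i j
      using cover[OF ups_cellD(2)[OF T that]] arr that unfolding arrows_def by blast
    then show ?thesis by auto
  qed
  ultimately show ?thesis
    using components_cover[OF assms]
    by (subst merge_all_eq[OF fin lab]) (simp add: split_eq_image image_image tree_def)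
qed

theorem theorem2p14:
  fixes i j :: nat and L :: "int set"
  assumes "finite L"
  shows "bij_betw split_tableau (alternative_tableaux L i j) (packed_partitions L i j) \<and>
    bij_betw merge_all (packed_partitions L i j) (alternative_tableaux L i j) \<and>
    (\<forall>T \<in> alternative_tableaux L i j. merge_all (split_tableau T) = T) \<and>
    (\<forall>P \<in> packed_partitions L i j. split_tableau (merge_all P) = P)"
proof -
  have ms: "\<forall>T \<in> alternative_tableaux L i j. merge_all (split_tableau T) = T"
    using merge_all_split by (simp add: alternative_tableaux_def)
  have sm: "\<forall>P \<in> packed_partitions L i j. split_tableau (merge_all P) = P"
    using split_merge_all assms by blast
  have s: "split_tableau ` alternative_tableaux L i j \<subseteq> packed_partitions L i j"
    using split_in_packed_partitions by blast
  have m: "merge_all ` packed_partitions L i j \<subseteq> alternative_tableaux L i j"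
    using merge_all_in_alternative_tableaux assms by blast
  show ?thesis
    using bij_betw_byWitness[OF ms sm s m] bij_betw_byWitness[OF sm ms m s] ms sm by blast
qed

end
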